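(* Let $n\le m$ be positive integers. Then for each integer $k$ with $m\le k\le mn$ there exist states $\rho\in\mathcal{C}(\frac1n I_n,\frac1m I_m)$ with $\mathrm{rank}\,\rho=k$.
   Context: A state (density operator) is a positive semidefinite operator of trace $1$ on a finite-dimensional complex Hilbert space. $\mathcal{C}(\frac1n I_n,\frac1m I_m)$ is the set of states $\rho$ on $\mathbb{C}^n\otimes\mathbb{C}^m$ with $\mathrm{tr}_B(\rho)=\frac1n I_n$ and $\mathrm{tr}_A(\rho)=\frac1m I_m$, where $\mathrm{tr}_A$ is the partial trace over the first factor $\mathbb{C}^n$, $\mathrm{tr}_B$ is the partial trace over the second factor $\mathbb{C}^m$, and $I_n$ is the $n\times n$ identity. *)

theory Defs
  imports "HOL-Analysis.Analysis" "HOL-Library.Complex_Order"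
begin

text \<open>
  Operators on the Hilbert space with orthonormal basis indexed by a finite type \<open>'i\<close> are
  matrices of type \<open>complex^'i^'i\<close>. The tensor product of the spaces with bases indexed by
  \<open>'n\<close> and \<open>'m\<close> has the product basis, indexed by \<open>'n \<times> 'm\<close>.
\<close>

text \<open>
  The order on \<^typ>\<open>complex\<close> is the one of \<^theory>\<open>HOL-Library.Complex_Order\<close>: \<open>0 \<le> z\<close> says that
  \<open>z\<close> is real and nonnegative. This forces \<open>A\<close> to be Hermitian.
\<close>
definition positive_semidefinite :: "complex^'i^'i \<Rightarrow> bool" where
  "positive_semidefinite A \<longleftrightarrow> (\<forall>x::complex^'i. 0 \<le> (\<Sum>i\<in>UNIV. cnj (x $ i) * (A *v x) $ i))"

definition state :: "complex^'i^'i \<Rightarrow> bool" where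
  "state \<rho> \<longleftrightarrow> positive_semidefinite \<rho> \<and> trace \<rho> = 1"

text \<open>The partial traces are named after the factor that is traced out.\<close>

definition tr_A :: "complex^('n::finite \<times> 'm::finite)^('n \<times> 'm) \<Rightarrow> complex^'m^'m" where
  "tr_A \<rho> = (\<chi> b b'. \<Sum>a\<in>UNIV. \<rho> $ (a, b) $ (a, b'))"

definition tr_B :: "complex^('n::finite \<times> 'm::finite)^('n \<times> 'm) \<Rightarrow> complex^'n^'n" where
  "tr_B \<rho> = (\<chi> a a'. \<Sum>b\<in>UNIV. \<rho> $ (a, b) $ (a', b))"

definition couplings ::
    "complex^'n^'n \<Rightarrow> complex^'m^'m \<Rightarrow> (complex^('n::finite \<times> 'm::finite)^('n \<times> 'm)) set" where
  "couplings \<sigma> \<tau> = {\<rho>. state \<rho> \<and> tr_B \<rho> = \<sigma> \<and> tr_A \<rho> = \<tau>}"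

end

theory Submission
  imports Defs
begin

text \<open>
  Partition the grid \<open>'n \<times> 'm\<close> into cells no two points of which share a row or a column, and let
  \<open>\<rho>\<close> have the entry \<open>1 / (m n)\<close> at \<open>(p, q)\<close> if \<open>p\<close> and \<open>q\<close> lie in the same cell, and \<open>0\<close> otherwise.
  The off-diagonal entries of \<open>\<rho>\<close> are then invisible to both partial traces, so both marginals are
  maximally mixed, and the rank of \<open>\<rho>\<close> is the number of cells. The \<open>m\<close> cyclic diagonals of
  the grid, which are transversal because \<open>n \<le> m\<close>, give such a partition into \<open>m\<close> cells, and
  splitting off one point at a time gives every number of cells up to \<open>m n\<close>.
\<close>

text \<open>A partition is given by a labelling \<open>c\<close> of the points by their cells.\<close>

definition cell_matrix :: "('i \<Rightarrow> 'c) \<Rightarrow> complex^'i^'i::finite" where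
  "cell_matrix c = (\<chi> p q. if c p = c q then 1 else 0)"

definition transversal :: "('n \<times> 'm \<Rightarrow> 'c) \<Rightarrow> bool" where
  "transversal c \<longleftrightarrow>
     (\<forall>a b a' b'. c (a, b) = c (a', b') \<and> (a = a' \<or> b = b') \<longrightarrow> a = a' \<and> b = b')"

text \<open>Grouping the coordinates of \<open>x\<close> by cell turns the quadratic form into the
  sum of |\<open>S y\<close>|^2 over the cells \<open>y\<close>, where \<open>S y\<close> adds up
  the coordinates of \<open>x\<close> in \<open>y\<close>.\<close>

lemma positive_semidefinite_cell_matrix: "positive_semidefinite (cell_matrix c)"
  unfolding positive_semidefinite_def
proof
  fix x :: "complex^'a"
  define S where "S y = (\<Sum>p\<in>{p. c p = y}. x $ p)" for y
  have mult: "(cell_matrix c *v x) $ p = S (c p)" for p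
    unfolding S_def matrix_vector_mult_def cell_matrix_def
    by (simp add: if_distrib[where f="\<lambda>t. t * _"] sum.If_cases eq_commute cong: if_cong)
  have "(\<Sum>p\<in>UNIV. cnj (x $ p) * (cell_matrix c *v x) $ p) =
        (\<Sum>y\<in>range c. \<Sum>p\<in>{p\<in>UNIV. c p = y}. cnj (x $ p) * S (c p))"
    unfolding mult by (rule sum.image_gen) simp
  also have "\<dots> = (\<Sum>y\<in>range c. cnj (S y) * S y)"
    by (rule sum.cong) (auto simp: S_def sum_distrib_right)
  also have "\<dots> \<ge> 0"
    by (rule sum_nonneg) (simp add: less_eq_complex_def)
  finally show "0 \<le> (\<Sum>p\<in>UNIV. cnj (x $ p) * (cell_matrix c *v x) $ p)" .
qed

lemma positive_semidefinite_scaleR: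
  assumes "positive_semidefinite A" "0 \<le> r"
  shows "positive_semidefinite (r *\<^sub>R A)"
  unfolding positive_semidefinite_def
proof
  fix x :: "complex^'a"
  have "(\<Sum>i\<in>UNIV. cnj (x $ i) * (r *\<^sub>R A *v x) $ i) =
        r *\<^sub>R (\<Sum>i\<in>UNIV. cnj (x $ i) * (A *v x) $ i)"
    by (simp add: matrix_vector_mult_def scaleR_sum_right[symmetric])
  then show "0 \<le> (\<Sum>i\<in>UNIV. cnj (x $ i) * (r *\<^sub>R A *v x) $ i)"
    using assms by (auto simp: positive_semidefinite_def less_eq_complex_def)
qed

text \<open>Rows of equal cells coincide, and rows of distinct cells have disjoint supports.\<close>

lemma rank_scaleR_cell_matrix:
  assumes "r \<noteq> 0"
  shows "rank (r *\<^sub>R cell_matrix c) = card (range c)"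
proof -
  define v :: "'b \<Rightarrow> complex^'a" where "v y = (\<chi> q. if y = c q then of_real r else 0)" for y
  have "row p (r *\<^sub>R cell_matrix c) = v (c p)" for p
    by (auto simp: row_def v_def cell_matrix_def vec_eq_iff scaleR_conv_of_real[where 'a=complex])
  then have rows: "rows (r *\<^sub>R cell_matrix c) = v ` range c"
    by (auto simp: rows_def)
  have inj: "inj_on v (range c)"
    using assms by (fastforce simp: inj_on_def v_def vec_eq_iff)
  have "vec.independent (v ` range c)"
  proof (subst vec.independent_explicit_finite_subsets, intro allI impI ballI)
    fix T u w
    assume T: "T \<subseteq> v ` range c" "finite T" and sum0: "(\<Sum>w\<in>T. u w *s w) = 0" and "w \<in> T"
    then obtain p where w: "w = v (c p)" by auto
    \<comment> \<open>Reading the linear relation at coordinate \<open>p\<close>, a point of the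
      cell of \<open>w\<close>, isolates the coefficient of \<open>w\<close>.\<close>
    have vanish: "w' $ p = 0" if "w' \<in> T - {w}" for w'
    proof -
      from that T(1) have "w' \<in> v ` range c" by blast
      then obtain y where y: "w' = v y" by blast
      with that w have "y \<noteq> c p" by blast
      then show ?thesis by (simp add: y v_def)
    qed
    have "0 = (\<Sum>w'\<in>T. u w' *s w') $ p" using sum0 by simp
    also have "\<dots> = (\<Sum>w'\<in>T. u w' * w' $ p)" by (simp add: sum_component)
    also have "\<dots> = u w * w $ p"
      using T \<open>w \<in> T\<close> vanish by (simp add: sum.remove)
    finally show "u w = 0" using assms by (simp add: w v_def)
  qed
  then show ?thesis
    unfolding row_rank_def_gen rows using inj by (simp add: vec.dim_eq_card_independent card_image)
qed

lemma scaleR_cell_matrix_in_couplings: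
  fixes c :: "'n::finite \<times> 'm::finite \<Rightarrow> 'c"
  assumes "transversal c"
  shows "(1 / (real CARD('n) * real CARD('m))) *\<^sub>R cell_matrix c \<in>
           couplings ((1 / real CARD('n)) *\<^sub>R mat 1) ((1 / real CARD('m)) *\<^sub>R mat 1)"
    (is "?\<rho> \<in> _")
proof -
  define \<rho> where "\<rho> = ?\<rho>"
  have entry: "\<rho> $ p $ q = (if c p = c q then 1 / (of_nat CARD('n) * of_nat CARD('m)) else 0)"
    for p q
    by (simp add: \<rho>_def cell_matrix_def scaleR_conv_of_real[where 'a=complex])
  \<comment> \<open>Hence an off-diagonal entry of \<open>tr_B \<rho>\<close> is a sum of zeros, and
    a diagonal one adds \<open>CARD('m)\<close> equal terms.\<close>
  have "c (a, b) = c (a', b) \<longleftrightarrow> a = a'" for a a' b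
    using assms unfolding transversal_def by blast
  then have "tr_B \<rho> = (1 / real CARD('n)) *\<^sub>R mat 1"
    by (simp add: tr_B_def entry vec_eq_iff mat_def scaleR_conv_of_real[where 'a=complex])
  moreover
  have "c (a, b) = c (a, b') \<longleftrightarrow> b = b'" for a b b'
    using assms unfolding transversal_def by blast
  then have "tr_A \<rho> = (1 / real CARD('m)) *\<^sub>R mat 1"
    by (simp add: tr_A_def entry vec_eq_iff mat_def scaleR_conv_of_real[where 'a=complex])
  moreover have "trace \<rho> = 1"
    by (simp add: trace_def entry)
  moreover have "positive_semidefinite \<rho>"
    unfolding \<rho>_def
    by (rule positive_semidefinite_scaleR[OF positive_semidefinite_cell_matrix]) simp
  ultimately show ?thesis
    by (simp add: couplings_def state_def \<rho>_def[symmetric])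
qed

text \<open>Number rows and columns from 0 and label a point by the sum of its two numbers modulo
  \<open>CARD('m)\<close>. Since n \<le> m, row numbers as well as column numbers are distinct
  residues, so fixing the label and one coordinate determines the other.\<close>

lemma cyclic_diagonals:
  assumes "CARD('n::finite) \<le> CARD('m::finite)"
  obtains c :: "'n::finite \<times> 'm::finite \<Rightarrow> nat" where "transversal c" "card (range c) = CARD('m)"
proof -
  let ?m = "CARD('m)"
  obtain f :: "'n \<Rightarrow> nat" where f: "bij_betw f UNIV {0..<CARD('n)}"
    using ex_bij_betw_finite_nat[of "UNIV :: 'n set"] by auto
  obtain g :: "'m \<Rightarrow> nat" where g: "bij_betw g UNIV {0..<?m}"
    using ex_bij_betw_finite_nat[of "UNIV :: 'm set"] by auto
  have f_less: "f a < ?m" for a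
    using bij_betwE[OF f] assms by (auto intro: less_le_trans)
  have g_less: "g b < ?m" for b
    using bij_betwE[OF g] by auto
  have f_eq: "f a = f a' \<longleftrightarrow> a = a'" for a a'
    using f by (auto simp: bij_betw_def inj_on_def)
  have g_eq: "g b = g b' \<longleftrightarrow> b = b'" for b b'
    using g by (auto simp: bij_betw_def inj_on_def)
  have cancel: "x = y" if "(z + x) mod ?m = (z + y) mod ?m" "x < ?m" "y < ?m" for x y z :: nat
    using that
  proof (induction x y rule: linorder_wlog)
    case (le x y)
    then have "?m dvd y - x"
      using mod_eq_dvd_iff_nat[of "z + x" "z + y" ?m] by simp
    then show ?case
      using le nat_dvd_not_less[of "y - x" ?m] by fastforce
  qed simp
  define c where "c = (\<lambda>(a, b). (f a + g b) mod ?m)"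
  have trans: "transversal c"
    unfolding transversal_def c_def
    using cancel[OF _ f_less f_less] cancel[OF _ g_less g_less]
    by (clarsimp simp: f_eq g_eq) (metis add.commute)
  have "card (range c) \<le> card {0..<?m}"
    by (rule card_mono) (auto simp: c_def)
  \<comment> \<open>Any single row, here the one at \<open>undefined\<close>, already carries
    \<open>CARD('m)\<close> distinct labels.\<close>
  moreover have "inj (\<lambda>b. c (undefined, b))"
    using trans unfolding inj_on_def transversal_def by blast
  then have "card (range (\<lambda>b. c (undefined, b))) = ?m"
    by (simp add: card_image)
  moreover have "card (range (\<lambda>b. c (undefined, b))) \<le> card (range c)"
    by (rule card_mono) auto
  ultimately have "card (range c) = ?m" by simp
  then show thesis using trans that by blast
qed

text \<open>With fewer cells than points, some cell has two points. Giving one of them a fresh label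
  adds a cell, and refining a partition preserves transversality.\<close>

lemma transversal_split:
  fixes c :: "'n::finite \<times> 'm::finite \<Rightarrow> nat"
  assumes "transversal c" "card (range c) < CARD('m) * CARD('n)"
  obtains c' :: "'n::finite \<times> 'm::finite \<Rightarrow> nat"
  where "transversal c'" "card (range c') = Suc (card (range c))"
proof -
  have "\<not> inj c"
    using assms(2) by (auto dest!: card_image simp: card_prod mult.commute)
  then obtain p q where pq: "p \<noteq> q" "c p = c q" by (auto simp: inj_def)
  obtain y where y: "y \<notin> range c"
    using ex_new_if_finite[of "range c"] by auto
  \<comment> \<open>The old label of \<open>p\<close> is not lost, because \<open>q\<close> still
    carries it.\<close>
  have "range (c(p := y)) = insert y (range c)"
    using pq by (auto simp: image_iff)
  then have "card (range (c(p := y))) = Suc (card (range c))"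
    using y by simp
  moreover have "transversal (c(p := y))"
    unfolding transversal_def
  proof (intro allI impI)
    fix a b a' b'
    assume H: "(c(p := y)) (a, b) = (c(p := y)) (a', b') \<and> (a = a' \<or> b = b')"
    have "c x \<noteq> y" for x
      using y by auto
    with H have "(a, b) = p \<and> (a', b') = p \<or> c (a, b) = c (a', b')"
      by (metis fun_upd_apply)
    with H assms(1) show "a = a' \<and> b = b'"
      unfolding transversal_def by blast
  qed
  ultimately show thesis using that by blast
qed

lemma ex_transversal:
  assumes "CARD('n::finite) \<le> CARD('m::finite)" "CARD('m) \<le> k" "k \<le> CARD('m) * CARD('n)"
  shows "\<exists>c :: 'n \<times> 'm \<Rightarrow> nat. transversal c \<and> card (range c) = k"
  using assms(2,3)
proof (induction k rule: dec_induct)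
  case base
  show ?case using cyclic_diagonals[OF assms(1)] by metis
next
  case (step k)
  then obtain c :: "'n \<times> 'm \<Rightarrow> nat" where "transversal c" "card (range c) = k" by auto
  with step.prems show ?case using transversal_split[of c] by (metis Suc_le_eq)
qed

theorem theorem4p2:
  fixes k :: nat
  assumes "CARD('n::finite) \<le> CARD('m::finite)"
    and "CARD('m) \<le> k"
    and "k \<le> CARD('m) * CARD('n)"
  shows "\<exists>\<rho> \<in> couplings ((1 / real CARD('n)) *\<^sub>R (mat 1 :: complex^'n^'n))
                         ((1 / real CARD('m)) *\<^sub>R (mat 1 :: complex^'m^'m)).
           rank \<rho> = k"
proof -
  obtain c :: "'n \<times> 'm \<Rightarrow> nat" where "transversal c" "card (range c) = k"
    using ex_transversal[OF assms] by blast
  then show ?thesis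
    using scaleR_cell_matrix_in_couplings[of c]
      rank_scaleR_cell_matrix[of "1 / (real CARD('n) * real CARD('m))" c]
    by (intro bexI[of _ "(1 / (real CARD('n) * real CARD('m))) *\<^sub>R cell_matrix c"]) simp_all
qed

end
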